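(* Let $\alpha,t_0\in\mathbb{R}$, let $\rho_0,c_0,\rho_1,c_1,K,d>0$, let $p\ge 1$, and let $\boldsymbol{U}_0:\mathbb{R}\to\mathbb{R}^2$ be a $C^p$ function with compact support included in $\Omega_0=(-\infty,\alpha)$. Let $\boldsymbol{U}=(v,\sigma)^T$ be a solution of $$ \left\{ \begin{array}{l} \dfrac{\partial \boldsymbol{U}}{\partial t}(x,t)+\boldsymbol{A}(x)\,\dfrac{\partial \boldsymbol{U}}{\partial x}(x,t)=\boldsymbol{0}\quad\text{for } x\in\mathbb{R},\ x\neq\alpha,\ t\geq t_0,\\[8pt] v(\alpha^+,t)=v(\alpha^-,t)+\dfrac{\rho_0c_0^2}{K}\,\dfrac{1}{\left(1-\frac{\sigma(\alpha^-,t)}{Kd}\right)^2}\,\dfrac{\partial v}{\partial x}(\alpha^-,t),\qquad \sigma(\alpha^+,t)=\sigma(\alpha^-,t)\quad\text{for } t\geq t_0,\\[8pt] \boldsymbol{U}(x,t_0)=\boldsymbol{U}_0(x)\quad\text{for } x\in\mathbb{R}. \end{array} \right. $$ Then the quantity $$ E(\boldsymbol{U},t)=\frac12\int_{-\infty}^{+\infty}\left(\rho\,v^2+\frac{1}{\rho c^2}\,\sigma^2\right)dx +K d^2\left(\ln\left(1-\frac{\sigma(\alpha^-,t)}{Kd}\right)+\frac{1}{1-\frac{\sigma(\alpha^-,t)}{Kd}}-1\right) $$ satisfies, for every $t\ge t_0$, $$ \frac{d\,E(\boldsymbol{U},t)}{dt}=0,\qquad E(\boldsymbol{U},t)\geq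 0,\qquad E(\boldsymbol{U},t)=0\ \Leftrightarrow\ \boldsymbol{U}(\cdot,t)=\boldsymbol{0}. $$
   Context: $\Omega_0=(-\infty,\alpha)$ and $\Omega_1=(\alpha,+\infty)$ are two linearly elastic media. The density $\rho$ and the wave speed $c$ are piecewise constant: $(\rho,c)=(\rho_0,c_0)$ on $\Omega_0$ and $(\rho,c)=(\rho_1,c_1)$ on $\Omega_1$, all positive. $K>0$ is the stiffness and $d>0$ the maximum allowable closure of the fracture located at $\alpha$. The unknown is $\boldsymbol{U}=(v,\sigma)^T$ (elastic velocity and stress), and $$\boldsymbol{A}(x)=\begin{pmatrix}0&-\frac1\rho\\ -\rho c^2&0\end{pmatrix},$$ so the system reads $\rho\,\partial_t v=\partial_x\sigma$, $\partial_t\sigma=\rho c^2\,\partial_x v$ on each side of $\alpha$. For a function $w$, $w(\alpha^\pm,t)$ denotes its limit at $\alpha$ from the right ($+$) or from the left ($-$). A solution is understood in the classical sense: $\boldsymbol{U}$ is $C^1$ on $\Omega_0\times[t_0,+\infty)$ and on $\Omega_1\times[t_0,+\infty)$, and on each side $\boldsymbol{U}$ and its first-order derivatives extend continuously up to $x=\alpha$. The solution is moreover required to satisfy $\sigma(\alpha^-,t)<Kd$ for all $t\geq t_0$ (the physical branch of the hyperbolic jump law). *)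

theory Defs
  imports "HOL-Analysis.Analysis"
begin

definition C_diff :: "nat \<Rightarrow> (real \<Rightarrow> 'a::real_normed_vector) \<Rightarrow> bool" where
  "C_diff p f \<longleftrightarrow>
     (\<exists>D. D 0 = f \<and>
          (\<forall>k<p. \<forall>x. (D k has_vector_derivative D (Suc k) x) (at x)) \<and>
          continuous_on UNIV (D p))"

definition supp :: "('a::topological_space \<Rightarrow> 'b::zero) \<Rightarrow> 'a set" where
  "supp f = closure {x. f x \<noteq> 0}"

definition left_lim :: "(real \<Rightarrow> 'a::t2_space) \<Rightarrow> real \<Rightarrow> 'a" where
  "left_lim w a = Lim (at_left a) w"

definition right_lim :: "(real \<Rightarrow> 'a::t2_space) \<Rightarrow> real \<Rightarrow> 'a" where
  "right_lim w a = Lim (at_right a) w"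

definition dx :: "(real \<Rightarrow> real \<Rightarrow> 'a::real_normed_vector) \<Rightarrow> real \<Rightarrow> real \<Rightarrow> 'a" where
  "dx w x t = vector_derivative (\<lambda>y. w y t) (at x)"

(* Time runs over {t0..}, so the derivative is one-sided at t0 and
   coincides with the ordinary derivative at every t > t0. *)
definition dt :: "real \<Rightarrow> (real \<Rightarrow> real \<Rightarrow> 'a::real_normed_vector) \<Rightarrow> real \<Rightarrow> real \<Rightarrow> 'a" where
  "dt t0 w x t = vector_derivative (\<lambda>s. w x s) (at t within {t0..})"

definition extends_continuously ::
    "real set \<Rightarrow> real \<Rightarrow> (real \<Rightarrow> real \<Rightarrow> 'a::real_normed_vector) \<Rightarrow> bool" where
  "extends_continuously \<Omega> t0 w \<longleftrightarrow>
     (\<exists>g. continuous_on (closure \<Omega> \<times> {t0..}) g \<and> (\<forall>x\<in>\<Omega>. \<forall>t\<ge>t0. g (x, t) = w x t))"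

(* w is C^1 on the open spatial domain \<Omega> for times t >= t0, and w and its two first-order
   partial derivatives extend continuously to the closure of \<Omega>; the extension condition
   contains the continuity of w and of its partial derivatives on \<Omega> itself. *)
definition C1_up_to_boundary ::
    "real set \<Rightarrow> real \<Rightarrow> (real \<Rightarrow> real \<Rightarrow> 'a::real_normed_vector) \<Rightarrow> bool" where
  "C1_up_to_boundary \<Omega> t0 w \<longleftrightarrow>
     (\<forall>x\<in>\<Omega>. \<forall>t\<ge>t0. (\<lambda>y. w y t) differentiable (at x) \<and>
                    (\<lambda>s. w x s) differentiable (at t within {t0..})) \<and>
     extends_continuously \<Omega> t0 w \<and>
     extends_continuously \<Omega> t0 (dx w) \<and>
     extends_continuously \<Omega> t0 (dt t0 w)"

(* The value at the interface a itself plays no role. *)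
definition piecewise_const :: "real \<Rightarrow> real \<Rightarrow> real \<Rightarrow> real \<Rightarrow> real" where
  "piecewise_const a l r x = (if x < a then l else r)"

definition elastic_matrix :: "real \<Rightarrow> real \<Rightarrow> real^2^2" where
  "elastic_matrix \<rho> c = vector [vector [0, - (1 / \<rho>)], vector [- (\<rho> * c\<^sup>2), 0]]"

definition velocity :: "(real \<Rightarrow> real \<Rightarrow> real^2) \<Rightarrow> real \<Rightarrow> real \<Rightarrow> real" where
  "velocity U x t = U x t $ 1"

definition stress :: "(real \<Rightarrow> real \<Rightarrow> real^2) \<Rightarrow> real \<Rightarrow> real \<Rightarrow> real" where
  "stress U x t = U x t $ 2"

definition energy_density ::
    "(real \<Rightarrow> real) \<Rightarrow> (real \<Rightarrow> real) \<Rightarrow> (real \<Rightarrow> real \<Rightarrow> real^2) \<Rightarrow> real \<Rightarrow> real \<Rightarrow> real" where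
  "energy_density \<rho> c U t x =
     \<rho> x * (velocity U x t)\<^sup>2 + 1 / (\<rho> x * (c x)\<^sup>2) * (stress U x t)\<^sup>2"

definition energy ::
    "real \<Rightarrow> (real \<Rightarrow> real) \<Rightarrow> (real \<Rightarrow> real) \<Rightarrow> real \<Rightarrow> real \<Rightarrow>
     (real \<Rightarrow> real \<Rightarrow> real^2) \<Rightarrow> real \<Rightarrow> real" where
  "energy \<alpha> \<rho> c K d U t =
     1/2 * (LINT x|lborel. energy_density \<rho> c U t x) +
     (let s = left_lim (\<lambda>x. stress U x t) \<alpha> in
      K * d\<^sup>2 * (ln (1 - s / (K * d)) + 1 / (1 - s / (K * d)) - 1))"

end

theory Submission
  imports Defs
begin

text \<open>
The energy is a bulk part, stored in the two media, plus a part stored in the fracture. Inside a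
medium the system is the wave equation in first-order form, and it gives
\<open>\<partial>\<^sub>t (\<rho> v\<^sup>2 + \<sigma>\<^sup>2 / (\<rho> c\<^sup>2)) = 2 \<partial>\<^sub>x (v \<sigma>)\<close>, so a bulk energy changes only by
the flux \<open>v \<sigma>\<close> through the ends of the interval over which it is taken (\<open>energy_balance\<close>).
No flux comes from far away: the Riemann invariants \<open>\<rho> c v + \<sigma>\<close> and \<open>\<sigma> - \<rho> c v\<close> are transported at
the speeds \<open>-c\<close> and \<open>c\<close>, so a compactly supported state is zero outside a bounded interval at
each later time (\<open>finite_speed\<close>). This also makes the bulk energy finite. On the right of the
fracture the state is at rest initially, and the disturbance that enters there starts at the fracture.

So the bulk energy changes at the rate \<open>- [v] s\<close>, the net flux at the fracture, where \<open>s\<close> is the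
common trace of the stress and \<open>[v]\<close> the jump of the velocity. Since \<open>\<partial>\<^sub>t \<sigma> = \<rho>0 c0\<^sup>2 \<partial>\<^sub>x v\<close> holds
up to the fracture, the jump law reads \<open>[v] = s' / (K (1 - s / (K d))\<^sup>2)\<close>; that is,
\<open>[v]\<close> is the time derivative of \<open>(s / K) / (1 - s / (K d))\<close>, the hyperbolic law for the
opening of the fracture. So \<open>[v] s\<close> is the time derivative of a function of \<open>s\<close> alone, the energy of the fracture (\<open>fracture_energy_deriv\<close>),
and the two contributions cancel.

The bulk energy is an integral of squares. With \<open>z = 1 - s / (K d) > 0\<close>, the fracture energy
is \<open>K d\<^sup>2 (ln z + 1 / z - 1)\<close>, which is nonnegative because \<open>ln (1 / z) \<le> 1 / z - 1\<close>. Hence the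
energy is nonnegative. If it is zero, then the bulk energy is zero, and so is the state on each side by continuity.
\<close>

section \<open>Transport along characteristics\<close>

text \<open>
Continuity of the partial derivatives makes \<open>w\<close> totally differentiable, up to the initial time included, so
the chain rule applies along the segment on which \<open>x + \<kappa> t\<close> is constant. The convexity of \<open>I\<close>
keeps this segment inside \<open>I\<close>.
\<close>

lemma constant_along_characteristic:
  fixes w wx :: "real \<Rightarrow> real \<Rightarrow> real" and \<kappa> :: real
  assumes I: "open I" "convex I"
    and w_x: "\<And>x t. x \<in> I \<Longrightarrow> t \<ge> t0 \<Longrightarrow> ((\<lambda>y. w y t) has_real_derivative wx x t) (at x)"
    and w_t: "\<And>x t. x \<in> I \<Longrightarrow> t \<ge> t0 \<Longrightarrow>
      ((\<lambda>\<tau>. w x \<tau>) has_real_derivative \<kappa> * wx x t) (at t within {t0..})"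
    and cont: "continuous_on (I \<times> {t0..}) (\<lambda>(x, t). wx x t)"
    and x: "x \<in> I" "x + \<kappa> * (t - t0) \<in> I" and t: "t \<ge> t0"
  shows "w x t = w (x + \<kappa> * (t - t0)) t0"
proof -
  define path where "path \<tau> = (x + \<kappa> * (t - \<tau>), \<tau>)" for \<tau>
  have total: "((\<lambda>(y, \<tau>). w y \<tau>) has_derivative
      (\<lambda>(h, k). wx y \<tau> * h + blinfun_scaleR_left (\<kappa> * wx y \<tau>) k)) (at (y, \<tau>) within I \<times> {t0..})"
    if "y \<in> I" "\<tau> \<ge> t0" for y \<tau>
  proof (rule has_derivative_partialsI)
    show "((\<lambda>z. w z \<tau>) has_derivative (\<lambda>h. wx y \<tau> * h)) (at y within I)"
      using w_x[OF that] by (auto simp: has_field_derivative_def intro: has_derivative_at_withinI)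
    show "((\<lambda>\<tau>. w z \<tau>) has_derivative blinfun_apply (blinfun_scaleR_left (\<kappa> * wx z s))) (at s within {t0..})"
      if "z \<in> I" "s \<in> {t0..}" for z s
    proof -
      have "blinfun_apply (blinfun_scaleR_left (\<kappa> * wx z s)) = (*) (\<kappa> * wx z s)"
        by (simp add: fun_eq_iff mult.commute)
      then show ?thesis
        using w_t[of z s] that by (simp only: has_field_derivative_def atLeast_iff)
    qed
    have "continuous_on (I \<times> {t0..}) (\<lambda>p. blinfun_scaleR_left (\<kappa> * (case p of (x, t) \<Rightarrow> wx x t)))"
      by (intro bounded_linear.continuous_on[OF bounded_linear_blinfun_scaleR_left] continuous_intros cont)
    then have "\<forall>p\<in>I \<times> {t0..}. continuous (at p within I \<times> {t0..})
        (\<lambda>p. blinfun_scaleR_left (\<kappa> * (case p of (x, t) \<Rightarrow> wx x t)))"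
      by (simp only: continuous_on_eq_continuous_within)
    then show "continuous (at (y, \<tau>) within I \<times> {t0..}) (\<lambda>(x, y). blinfun_scaleR_left (\<kappa> * wx x y))"
      using \<open>y \<in> I\<close> \<open>\<tau> \<ge> t0\<close> unfolding case_prod_unfold by blast
  qed (use that in auto)
  have path_in: "path \<tau> \<in> I \<times> {t0..}" if "\<tau> \<in> {t0..t}" for \<tau>
  proof (cases "t = t0")
    case True
    then show ?thesis using that x by (auto simp: path_def)
  next
    case False
    then have pos: "t - t0 > 0" using t by simp
    define u where "u = (t - \<tau>) / (t - t0)"
    have u: "0 \<le> u" "u \<le> 1" "t - \<tau> = u * (t - t0)"
      using that pos by (auto simp: u_def field_simps)
    have "(1 - u) *\<^sub>R x + u *\<^sub>R (x + \<kappa> * (t - t0)) \<in> I"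
      using u x I(2) by (intro convexD) auto
    also have "(1 - u) *\<^sub>R x + u *\<^sub>R (x + \<kappa> * (t - t0)) = x + \<kappa> * (t - \<tau>)"
      unfolding u(3) by (simp add: algebra_simps)
    finally show ?thesis using that by (simp add: path_def)
  qed
  have "((\<lambda>\<tau>. case path \<tau> of (y, s) \<Rightarrow> w y s) has_derivative (\<lambda>h. 0)) (at \<tau> within {t0..t})"
    if "\<tau> \<in> {t0..t}" for \<tau>
  proof -
    have path': "(path has_derivative (\<lambda>h. (- \<kappa> * h, h))) (at \<tau> within {t0..t})"
      unfolding path_def by (auto intro!: derivative_eq_intros)
    have w': "((\<lambda>(y, s). w y s) has_derivative (\<lambda>(h, k). wx (x + \<kappa> * (t - \<tau>)) \<tau> * h
        + blinfun_scaleR_left (\<kappa> * wx (x + \<kappa> * (t - \<tau>)) \<tau>) k)) (at (path \<tau>) within I \<times> {t0..})"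
      using total path_in[OF that] by (simp add: path_def)
    have "path ` {t0..t} \<subseteq> I \<times> {t0..}"
      using path_in by blast
    from has_derivative_in_compose[OF path' has_derivative_subset[OF w' this]] show ?thesis
      by (simp add: mult.left_commute)
  qed
  from has_derivative_zero_constant[OF _ this] obtain k
    where "\<And>\<tau>. \<tau> \<in> {t0..t} \<Longrightarrow> (case path \<tau> of (y, s) \<Rightarrow> w y s) = k"
    by auto
  from this[of t] this[of t0] show ?thesis
    using t by (auto simp: path_def)
qed

section \<open>Traces on the boundary\<close>

lemma continuous_on_slices:
  assumes "continuous_on (A \<times> B) (\<lambda>(x, t). w x t)"
  shows "t \<in> B \<Longrightarrow> continuous_on A (\<lambda>x. w x t)"
    and "x \<in> A \<Longrightarrow> continuous_on B (\<lambda>t. w x t)"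
    and "continuous_on (B \<times> A) (\<lambda>(t, x). w x t)"
proof -
  note compose = continuous_on_compose2[OF assms[unfolded case_prod_unfold]]
  have "continuous_on A (\<lambda>x. (x, t))" "continuous_on B (\<lambda>t. (x, t))"
    "continuous_on (B \<times> A) (\<lambda>p. (snd p, fst p))"
    by (intro continuous_intros)+
  note parts = compose[OF this(1)] compose[OF this(2)] compose[OF this(3)]
  show "continuous_on A (\<lambda>x. w x t)" if "t \<in> B"
    using parts(1) that by (simp add: image_subset_iff)
  show "continuous_on B (\<lambda>t. w x t)" if "x \<in> A"
    using parts(2) that by (simp add: image_subset_iff)
  show "continuous_on (B \<times> A) (\<lambda>(t, x). w x t)"
    unfolding case_prod_unfold using parts(3) by (simp add: image_subset_iff)
qed

text \<open>
A limit of differentiable functions need not be differentiable, so the derivative at a boundary point of \<open>I\<close> is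
not just the limit of the derivatives at inner points. The integrated identity \<open>w x t = w x t0 + \<integral> wt x\<close>, however, is closed under limits in \<open>x\<close> and can be
differentiated again. The lemma gives the evolution of the trace of the stress at the fracture.
\<close>

lemma has_time_derivative_on_closure:
  fixes w wt :: "real \<Rightarrow> real \<Rightarrow> real"
  assumes w: "continuous_on (closure I \<times> {t0..}) (\<lambda>(x, t). w x t)"
    and wt: "continuous_on (closure I \<times> {t0..}) (\<lambda>(x, t). wt x t)"
    and der: "\<And>x t. x \<in> I \<Longrightarrow> t \<ge> t0 \<Longrightarrow>
      ((\<lambda>\<tau>. w x \<tau>) has_real_derivative wt x t) (at t within {t0..})"
    and x: "x \<in> closure I" and t: "t \<ge> t0"
  shows "((\<lambda>\<tau>. w x \<tau>) has_real_derivative wt x t) (at t within {t0..})"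
proof -
  have increment: "w x \<tau> - w x t0 - integral {t0..\<tau>} (wt x) = 0" if "\<tau> \<ge> t0" for \<tau>
  proof (rule continuous_constant_on_closure[OF _ _ x])
    have [continuous_intros]: "continuous_on (closure I) (\<lambda>x. w x s)" if "s \<ge> t0" for s
      using that by (intro continuous_on_slices(1)[OF w]) auto
    have "continuous_on (closure I) (\<lambda>x. integral (cbox t0 \<tau>) (wt x))"
      by (intro integral_continuous_on_param continuous_on_subset[OF wt]) auto
    then show "continuous_on (closure I) (\<lambda>x. w x \<tau> - w x t0 - integral {t0..\<tau>} (wt x))"
      using that by (auto intro!: continuous_intros)
    fix y assume "y \<in> I"
    have "(wt y has_integral w y \<tau> - w y t0) {t0..\<tau>}"
    proof (rule fundamental_theorem_of_calculus[OF that])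
      fix s assume "s \<in> {t0..\<tau>}"
      then show "((\<lambda>\<tau>. w y \<tau>) has_vector_derivative wt y s) (at s within {t0..\<tau>})"
        using der[OF \<open>y \<in> I\<close>, of s]
        by (auto simp: has_real_derivative_iff_has_vector_derivative[symmetric] intro: DERIV_subset)
    qed
    then show "w y \<tau> - w y t0 - integral {t0..\<tau>} (wt y) = 0"
      by (simp add: integral_unique)
  qed
  have "continuous_on {t0..t + 1} (wt x)"
    by (rule continuous_on_subset[OF continuous_on_slices(2)[OF wt x]]) auto
  then have "((\<lambda>\<tau>. integral {t0..\<tau>} (wt x)) has_real_derivative wt x t) (at t within {t0..t + 1})"
    using t by (intro integral_has_real_derivative) auto
  then have "((\<lambda>\<tau>. w x t0 + integral {t0..\<tau>} (wt x)) has_real_derivative wt x t) (at t within {t0..t + 1})"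
    by (auto intro!: derivative_eq_intros)
  then have "((\<lambda>\<tau>. w x \<tau>) has_real_derivative wt x t) (at t within {t0..t + 1})"
  proof (rule has_field_derivative_transform_within[where d = 1])
    show "w x t0 + integral {t0..\<tau>} (wt x) = w x \<tau>" if "\<tau> \<in> {t0..t + 1}" for \<tau>
      using increment[of \<tau>] that by simp
  qed (use t in auto)
  \<comment> \<open>The primitive lives on a compact interval; the final time \<open>t + 1\<close> leaves room to the right of \<open>t\<close>.\<close>
  moreover have "at t within {t0..t + 1} = at t within {t0..}"
    by (rule at_within_nhd[of _ "{..<t + 1}"]) auto
  ultimately show ?thesis by simp
qed

lemma left_lim_eq:
  assumes "continuous_on (closure {..<a}) g" "\<And>x. x < a \<Longrightarrow> f x = g x"
  shows "left_lim f a = g a"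
proof -
  have "(g \<longlongrightarrow> g a) (at a within {..a})"
    using assms(1) by (simp add: continuous_on_def)
  then have "(g \<longlongrightarrow> g a) (at_left a)"
    by (rule tendsto_within_subset) auto
  moreover have "\<forall>\<^sub>F x in at_left a. g x = f x"
    using assms(2) by (auto simp: eventually_at_filter)
  ultimately have "(f \<longlongrightarrow> g a) (at_left a)"
    by (rule Lim_transform_eventually)
  then show ?thesis
    unfolding left_lim_def by (intro tendsto_Lim) auto
qed

lemma right_lim_eq:
  assumes "continuous_on (closure {a<..}) g" "\<And>x. x > a \<Longrightarrow> f x = g x"
  shows "right_lim f a = g a"
proof -
  have "(g \<longlongrightarrow> g a) (at a within {a..})"
    using assms(1) by (simp add: continuous_on_def)
  then have "(g \<longlongrightarrow> g a) (at_right a)"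
    by (rule tendsto_within_subset) auto
  moreover have "\<forall>\<^sub>F x in at_right a. g x = f x"
    using assms(2) by (auto simp: eventually_at_filter)
  ultimately have "(f \<longlongrightarrow> g a) (at_right a)"
    by (rule Lim_transform_eventually)
  then show ?thesis
    unfolding right_lim_def by (intro tendsto_Lim) auto
qed

section \<open>Waves in a homogeneous medium\<close>

text \<open>
A state of one homogeneous medium that is \<open>C\<^sup>1\<close> up to the boundary. The functions \<open>v\<close> (velocity), \<open>s\<close> (stress)
and their space derivatives are the continuous extensions to \<open>closure I\<close>, so their values at a boundary point are
the traces of the solution. The wave system is built in: the time derivatives are expressed by \<open>sx\<close> and \<open>vx\<close>.
\<close>

locale elastic_medium =
  fixes I :: "real set" and t0 \<rho> c :: real
    and v s vx sx :: "real \<Rightarrow> real \<Rightarrow> real"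
  assumes rho_pos: "\<rho> > 0" and c_pos: "c > 0"
    and open_I: "open I" and convex_I: "convex I"
    and cont_v: "continuous_on (closure I \<times> {t0..}) (\<lambda>(x, t). v x t)"
    and cont_s: "continuous_on (closure I \<times> {t0..}) (\<lambda>(x, t). s x t)"
    and cont_vx: "continuous_on (closure I \<times> {t0..}) (\<lambda>(x, t). vx x t)"
    and cont_sx: "continuous_on (closure I \<times> {t0..}) (\<lambda>(x, t). sx x t)"
    and v_x: "x \<in> I \<Longrightarrow> t \<ge> t0 \<Longrightarrow> ((\<lambda>y. v y t) has_real_derivative vx x t) (at x)"
    and s_x: "x \<in> I \<Longrightarrow> t \<ge> t0 \<Longrightarrow> ((\<lambda>y. s y t) has_real_derivative sx x t) (at x)"
    and v_t: "x \<in> I \<Longrightarrow> t \<ge> t0 \<Longrightarrow>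
      ((\<lambda>\<tau>. v x \<tau>) has_real_derivative sx x t / \<rho>) (at t within {t0..})"
    and s_t: "x \<in> I \<Longrightarrow> t \<ge> t0 \<Longrightarrow>
      ((\<lambda>\<tau>. s x \<tau>) has_real_derivative \<rho> * c\<^sup>2 * vx x t) (at t within {t0..})"
begin

text \<open>
Both characteristic families at once: \<open>\<kappa> = c\<close> is the wave travelling to the left, \<open>\<kappa> = -c\<close> the wave
travelling to the right.
\<close>

lemma Riemann_invariant:
  assumes \<kappa>: "\<kappa>\<^sup>2 = c\<^sup>2"
    and x: "x \<in> I" "x + \<kappa> * (t - t0) \<in> I" and t: "t \<ge> t0"
  defines "w \<equiv> \<lambda>x t. \<rho> * \<kappa> * v x t + s x t"
  shows "w x t = w (x + \<kappa> * (t - t0)) t0"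
proof (rule constant_along_characteristic[OF open_I convex_I, where w = w and \<kappa> = \<kappa> and wx = "\<lambda>x t. \<rho> * \<kappa> * vx x t + sx x t"])
  have "I \<times> {t0..} \<subseteq> closure I \<times> {t0..}" using closure_subset by auto
  note [continuous_intros] = continuous_on_subset[OF cont_vx[unfolded case_prod_unfold] this]
    continuous_on_subset[OF cont_sx[unfolded case_prod_unfold] this]
  show "continuous_on (I \<times> {t0..}) (\<lambda>(x, t). \<rho> * \<kappa> * vx x t + sx x t)"
    unfolding case_prod_unfold by (intro continuous_intros)
  fix y \<tau> assume "y \<in> I" "t0 \<le> \<tau>"
  then show "((\<lambda>y. w y \<tau>) has_real_derivative \<rho> * \<kappa> * vx y \<tau> + sx y \<tau>) (at y)"
    unfolding w_def by (intro DERIV_add DERIV_cmult v_x s_x)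
  have "\<rho> * \<kappa> * (sx y \<tau> / \<rho>) + \<rho> * c\<^sup>2 * vx y \<tau> = \<kappa> * (\<rho> * \<kappa> * vx y \<tau> + sx y \<tau>)"
    unfolding \<kappa>[symmetric] using rho_pos by (simp add: field_simps power2_eq_square)
  moreover have "((\<lambda>\<tau>. w y \<tau>) has_real_derivative \<rho> * \<kappa> * (sx y \<tau> / \<rho>) + \<rho> * c\<^sup>2 * vx y \<tau>) (at \<tau> within {t0..})"
    unfolding w_def by (intro DERIV_add DERIV_cmult v_t s_t \<open>y \<in> I\<close> \<open>t0 \<le> \<tau>\<close>)
  ultimately show "((\<lambda>\<tau>. w y \<tau>) has_real_derivative \<kappa> * (\<rho> * \<kappa> * vx y \<tau> + sx y \<tau>)) (at \<tau> within {t0..})"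
    by simp
qed (use x t in auto)

text \<open>
The two Riemann invariants at \<open>(x, t)\<close> come from the two feet of the characteristics at time \<open>t0\<close>, and
together they determine velocity and stress.
\<close>

lemma finite_speed:
  assumes x: "x \<in> I" "x + c * (t - t0) \<in> I" "x - c * (t - t0) \<in> I" and t: "t \<ge> t0"
    and "v (x + c * (t - t0)) t0 = 0" "s (x + c * (t - t0)) t0 = 0"
    and "v (x - c * (t - t0)) t0 = 0" "s (x - c * (t - t0)) t0 = 0"
  shows "v x t = 0" "s x t = 0"
proof -
  have "\<rho> * c * v x t + s x t = 0"
    using Riemann_invariant[of c x t] assms by simp
  moreover have "- (\<rho> * c * v x t) + s x t = 0"
    using Riemann_invariant[of "- c" x t] assms by simp
  ultimately have "s x t = 0" "\<rho> * c * v x t = 0" by linarith+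
  then show "v x t = 0" "s x t = 0"
    using rho_pos c_pos by auto
qed

lemma time_derivatives_on_closure:
  assumes "x \<in> closure I" "t \<ge> t0"
  shows "((\<lambda>\<tau>. v x \<tau>) has_real_derivative sx x t / \<rho>) (at t within {t0..})"
    and "((\<lambda>\<tau>. s x \<tau>) has_real_derivative \<rho> * c\<^sup>2 * vx x t) (at t within {t0..})"
proof -
  note [continuous_intros] = cont_vx[unfolded case_prod_unfold] cont_sx[unfolded case_prod_unfold]
  show "((\<lambda>\<tau>. v x \<tau>) has_real_derivative sx x t / \<rho>) (at t within {t0..})"
    by (rule has_time_derivative_on_closure[OF cont_v _ v_t assms])
      (use rho_pos in \<open>auto simp: case_prod_unfold intro!: continuous_intros\<close>)
  show "((\<lambda>\<tau>. s x \<tau>) has_real_derivative \<rho> * c\<^sup>2 * vx x t) (at t within {t0..})"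
    by (rule has_time_derivative_on_closure[OF cont_s _ s_t assms])
      (auto simp: case_prod_unfold intro!: continuous_intros)
qed

definition density :: "real \<Rightarrow> real \<Rightarrow> real" where
  "density t x = \<rho> * (v x t)\<^sup>2 + 1 / (\<rho> * c\<^sup>2) * (s x t)\<^sup>2"

lemma density_nonneg: "density t x \<ge> 0"
  using rho_pos by (simp add: density_def)

lemma density_eq_0_iff: "density t x = 0 \<longleftrightarrow> v x t = 0 \<and> s x t = 0"
  using rho_pos c_pos by (auto simp: density_def add_nonneg_eq_0_iff)

lemma continuous_slices:
  assumes "t \<ge> t0"
  shows "continuous_on (closure I) (\<lambda>x. v x t)" "continuous_on (closure I) (\<lambda>x. s x t)"
    "continuous_on (closure I) (\<lambda>x. vx x t)" "continuous_on (closure I) (\<lambda>x. sx x t)"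
  using assms continuous_on_slices(1)[OF cont_v] continuous_on_slices(1)[OF cont_s]
    continuous_on_slices(1)[OF cont_vx] continuous_on_slices(1)[OF cont_sx]
  by auto

lemma continuous_on_density: "t \<ge> t0 \<Longrightarrow> continuous_on (closure I) (density t)"
  unfolding density_def by (intro continuous_intros continuous_slices)

text \<open>
The time derivative of the density is the space derivative of \<open>2 v s\<close>, by the wave system. One therefore
differentiates under the integral sign and then applies the fundamental theorem of calculus. The interval may reach
the boundary of \<open>I\<close>, which is where the fracture sits.
\<close>

lemma energy_balance:
  assumes ab: "a \<le> b" "{a..b} \<subseteq> closure I" "{a<..<b} \<subseteq> I" and t: "t \<ge> t0"
  shows "((\<lambda>\<tau>. integral {a..b} (density \<tau>)) has_real_derivative
    2 * (v b t * s b t - v a t * s a t)) (at t within {t0..})"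
proof -
  define rate where "rate \<tau> x = 2 * (v x \<tau> * sx x \<tau> + s x \<tau> * vx x \<tau>)" for \<tau> x
  have "((\<lambda>\<tau>. integral (cbox a b) (density \<tau>)) has_vector_derivative integral (cbox a b) (rate t))
      (at t within {t0..})"
  proof (rule leibniz_rule_vector_derivative)
    fix \<tau> x assume \<tau>: "\<tau> \<in> {t0..}" and x: "x \<in> cbox a b"
    then have x: "x \<in> closure I" using ab by auto
    have "((\<lambda>\<tau>. density \<tau> x) has_real_derivative
        \<rho> * (2 * (v x \<tau> * (sx x \<tau> / \<rho>))) + 1 / (\<rho> * c\<^sup>2) * (2 * (s x \<tau> * (\<rho> * c\<^sup>2 * vx x \<tau>))))
        (at \<tau> within {t0..})"
      unfolding density_def power2_eq_square
      using time_derivatives_on_closure[OF x, of \<tau>] \<tau>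
      by (intro DERIV_add DERIV_cmult DERIV_cong[OF DERIV_mult]) (auto simp: power2_eq_square)
    moreover have "\<rho> * (2 * (v x \<tau> * (sx x \<tau> / \<rho>))) + 1 / (\<rho> * c\<^sup>2) * (2 * (s x \<tau> * (\<rho> * c\<^sup>2 * vx x \<tau>)))
        = rate \<tau> x"
      using rho_pos c_pos by (simp add: rate_def)
    ultimately show "((\<lambda>\<tau>. density \<tau> x) has_vector_derivative rate \<tau> x) (at \<tau> within {t0..})"
      by (simp add: has_real_derivative_iff_has_vector_derivative)
  next
    fix \<tau> assume "\<tau> \<in> {t0..}"
    then show "density \<tau> integrable_on cbox a b"
      using continuous_on_subset[OF continuous_on_density ab(2)] integrable_continuous_real by auto
  next
    have "{t0..} \<times> cbox a b \<subseteq> {t0..} \<times> closure I" using ab(2) by auto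
    note * = continuous_on_subset[OF continuous_on_slices(3) this]
    note [continuous_intros] = *[OF cont_v, unfolded case_prod_unfold] *[OF cont_s, unfolded case_prod_unfold]
      *[OF cont_vx, unfolded case_prod_unfold] *[OF cont_sx, unfolded case_prod_unfold]
    show "continuous_on ({t0..} \<times> cbox a b) (\<lambda>(\<tau>, x). rate \<tau> x)"
      unfolding rate_def case_prod_unfold by (intro continuous_intros)
  qed (use t in auto)
  moreover have "(rate t has_integral 2 * (v b t * s b t) - 2 * (v a t * s a t)) {a..b}"
  proof (rule fundamental_theorem_of_calculus_interior[OF ab(1)])
    show "continuous_on {a..b} (\<lambda>x. 2 * (v x t * s x t))"
      by (intro continuous_intros continuous_on_subset[OF continuous_slices(1) ab(2)]
          continuous_on_subset[OF continuous_slices(2) ab(2)] t)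
    fix x assume "x \<in> {a<..<b}"
    then have "x \<in> I" using ab by auto
    then have "((\<lambda>x. 2 * (v x t * s x t)) has_real_derivative rate t x) (at x)"
      using v_x[of x t] s_x[of x t] t unfolding rate_def
      by (intro DERIV_cmult DERIV_cong[OF DERIV_mult]) auto
    then show "((\<lambda>x. 2 * (v x t * s x t)) has_vector_derivative rate t x) (at x)"
      by (simp add: has_real_derivative_iff_has_vector_derivative)
  qed
  ultimately show ?thesis
    by (simp add: has_real_derivative_iff_has_vector_derivative integral_unique right_diff_distrib)
qed

end

text \<open>
On each side of the fracture a vector-valued classical solution is a state of a homogeneous medium. The four
scalar fields are the components of the continuous extensions of \<open>U\<close> and \<open>dx U\<close>.
\<close>

lemma elastic_medium_of_solution:
  assumes coeffs: "\<rho> > 0" "c > 0" and I: "open I" "convex I"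
    and regular: "C1_up_to_boundary I t0 U"
    and pde: "\<And>x t. x \<in> I \<Longrightarrow> t \<ge> t0 \<Longrightarrow> dt t0 U x t + elastic_matrix \<rho> c *v dx U x t = 0"
  obtains v s vx sx where "elastic_medium I t0 \<rho> c v s vx sx"
    "\<And>x t. x \<in> I \<Longrightarrow> t \<ge> t0 \<Longrightarrow> velocity U x t = v x t"
    "\<And>x t. x \<in> I \<Longrightarrow> t \<ge> t0 \<Longrightarrow> stress U x t = s x t"
    "\<And>x t. x \<in> I \<Longrightarrow> t \<ge> t0 \<Longrightarrow> dx (velocity U) x t = vx x t"
proof -
  obtain g where g: "continuous_on (closure I \<times> {t0..}) g" "\<And>x t. x \<in> I \<Longrightarrow> t \<ge> t0 \<Longrightarrow> U x t = g (x, t)"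
    using regular unfolding C1_up_to_boundary_def extends_continuously_def by metis
  obtain h where h: "continuous_on (closure I \<times> {t0..}) h" "\<And>x t. x \<in> I \<Longrightarrow> t \<ge> t0 \<Longrightarrow> dx U x t = h (x, t)"
    using regular unfolding C1_up_to_boundary_def extends_continuously_def by metis
  have space: "((\<lambda>y. U y t $ i) has_real_derivative h (x, t) $ i) (at x)" if "x \<in> I" "t \<ge> t0" for x t i
  proof -
    have "((\<lambda>y. U y t) has_vector_derivative h (x, t)) (at x)"
      using regular that unfolding C1_up_to_boundary_def h(2)[OF that, symmetric] dx_def
      by (simp add: vector_derivative_works)
    from bounded_linear.has_vector_derivative[OF bounded_linear_vec_nth this]
    show ?thesis by (simp add: has_real_derivative_iff_has_vector_derivative)
  qed
  have space_g: "((\<lambda>y. g (y, t) $ i) has_real_derivative h (x, t) $ i) (at x)" if "x \<in> I" "t \<ge> t0" for x t i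
    using has_field_derivative_transform_within_open[OF space[OF that] I(1) that(1)] g(2) that(2) by simp
  have pde': "dt t0 U x t $ 1 = h (x, t) $ 2 / \<rho>" "dt t0 U x t $ 2 = \<rho> * c\<^sup>2 * (h (x, t) $ 1)"
    if "x \<in> I" "t \<ge> t0" for x t
    using arg_cong[OF pde[OF that], of "\<lambda>u. u $ 1"] arg_cong[OF pde[OF that], of "\<lambda>u. u $ 2"] h(2)[OF that]
    by (simp_all add: elastic_matrix_def matrix_vector_mult_def sum_2)
  have time_g: "((\<lambda>\<tau>. g (x, \<tau>) $ i) has_real_derivative dt t0 U x t $ i) (at t within {t0..})"
    if "x \<in> I" "t \<ge> t0" for x t i
  proof -
    have "((\<lambda>\<tau>. U x \<tau>) has_vector_derivative dt t0 U x t) (at t within {t0..})"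
      using regular that unfolding C1_up_to_boundary_def dt_def
      by (simp add: vector_derivative_works)
    from bounded_linear.has_vector_derivative[OF bounded_linear_vec_nth this]
    have "((\<lambda>\<tau>. U x \<tau> $ i) has_real_derivative dt t0 U x t $ i) (at t within {t0..})"
      by (simp add: has_real_derivative_iff_has_vector_derivative)
    then show ?thesis
      by (rule has_field_derivative_transform_within[where d = 1]) (use that g(2) in auto)
  qed
  have cont: "continuous_on (closure I \<times> {t0..}) (\<lambda>(x, t). f (x, t) $ i)"
    if "continuous_on (closure I \<times> {t0..}) f" for f :: "real \<times> real \<Rightarrow> real^2" and i
    using that by (auto simp: case_prod_unfold intro: continuous_intros)
  have "elastic_medium I t0 \<rho> c (\<lambda>x t. g (x, t) $ 1) (\<lambda>x t. g (x, t) $ 2)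
      (\<lambda>x t. h (x, t) $ 1) (\<lambda>x t. h (x, t) $ 2)"
    using coeffs I space_g time_g pde' cont[OF g(1)] cont[OF h(1)]
    by (auto intro!: elastic_medium.intro simp flip: pde')
  moreover have "dx (velocity U) x t = h (x, t) $ 1" if "x \<in> I" "t \<ge> t0" for x t
    using space[OF that, of 1] unfolding dx_def velocity_def
    by (intro vector_derivative_at) (simp add: has_real_derivative_iff_has_vector_derivative)
  ultimately show ?thesis
    using g(2) by (intro that) (auto simp: velocity_def stress_def)
qed

section \<open>The energy stored in the fracture\<close>

lemma ln_plus_inverse_nonneg:
  fixes z :: real
  assumes "z > 0"
  shows "ln z + 1 / z - 1 \<ge> 0"
  using ln_le_minus_one[of "1 / z"] assms by (simp add: ln_div)

definition fracture_energy :: "real \<Rightarrow> real \<Rightarrow> real \<Rightarrow> real" where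
  "fracture_energy K d s = K * d\<^sup>2 * (ln (1 - s / (K * d)) + 1 / (1 - s / (K * d)) - 1)"

lemma fracture_energy_nonneg:
  assumes "K > 0" "d > 0" "s < K * d"
  shows "fracture_energy K d s \<ge> 0"
  using ln_plus_inverse_nonneg[of "1 - s / (K * d)"] assms
  by (simp add: fracture_energy_def)

text \<open>
Multiplied by the time derivative of \<open>s\<close>, this is the power \<open>[v] s\<close> that the waves deliver to the fracture
under the hyperbolic jump law.
\<close>

lemma fracture_energy_deriv:
  assumes "K > 0" "d > 0" "s < K * d"
  shows "(fracture_energy K d has_real_derivative s / (K * (1 - s / (K * d))\<^sup>2)) (at s)"
proof -
  define z where "z = 1 - s / (K * d)"
  have z: "z > 0" and s: "s = K * d * (1 - z)"
    using assms by (simp_all add: z_def)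
  have "((\<lambda>s. K * d\<^sup>2 * (ln (1 - s / (K * d)) + 1 / (1 - s / (K * d)) - 1)) has_real_derivative
      K * d\<^sup>2 * (- (1 / (K * d)) / z + 1 / (K * d) / z\<^sup>2)) (at s)"
    using z assms unfolding z_def
    by (auto intro!: derivative_eq_intros simp: power2_eq_square)
  moreover have "K * d\<^sup>2 * (- (1 / (K * d)) / z + 1 / (K * d) / z\<^sup>2) = s / (K * z\<^sup>2)"
    unfolding s using z assms by (simp add: field_simps power2_eq_square)
  ultimately show ?thesis
    unfolding fracture_energy_def[abs_def] z_def by simp
qed

section \<open>Conservation and positivity of the energy\<close>

text \<open>
The value of \<open>f\<close> at the point \<open>m\<close> is left free, as the value of the solution at the fracture is.
\<close>

lemma integral_two_pieces:
  fixes f e0 e1 :: "real \<Rightarrow> real"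
  assumes e0: "continuous_on {a..m} e0" and e1: "continuous_on {m..b} e1"
    and left: "\<And>x. a \<le> x \<Longrightarrow> x < m \<Longrightarrow> f x = e0 x"
    and right: "\<And>x. m < x \<Longrightarrow> x \<le> b \<Longrightarrow> f x = e1 x"
    and outside: "\<And>x. x < a \<or> b < x \<Longrightarrow> f x = 0"
    and ab: "a \<le> m" "m \<le> b"
  shows "integrable lborel f"
    and "(LINT x|lborel. f x) = integral {a..m} e0 + integral {m..b} e1"
proof -
  define g where "g x = indicator {a..m} x *\<^sub>R e0 x + indicator {m..b} x *\<^sub>R e1 x" for x
  note i0 = borel_integrable_atLeastAtMost'[OF e0] and i1 = borel_integrable_atLeastAtMost'[OF e1]
  have g: "integrable lborel g"
    using i0 i1 unfolding g_def set_integrable_def by (rule Bochner_Integration.integrable_add)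
  have g_int: "(LINT x|lborel. g x) = integral {a..m} e0 + integral {m..b} e1"
    using i0 i1 set_borel_integral_eq_integral(2)[OF i0] set_borel_integral_eq_integral(2)[OF i1]
    by (simp add: g_def set_integrable_def set_lebesgue_integral_def)
  have eq: "f x = g x" if "x \<notin> {m}" for x
    using left[of x] right[of x] outside[of x] that ab
    by (cases "x < m") (auto simp: g_def indicator_def)
  show "integrable lborel f"
    using g integrable_discrete_difference[of "{m}" lborel f g] eq by simp
  show "(LINT x|lborel. f x) = integral {a..m} e0 + integral {m..b} e1"
    using g_int integral_discrete_difference[of "{m}" lborel f g] eq by simp
qed

theorem lemma1:
  fixes \<alpha> t0 \<rho>0 c0 \<rho>1 c1 K d :: real
    and p :: nat
    and U0 :: "real \<Rightarrow> real^2"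
    and U :: "real \<Rightarrow> real \<Rightarrow> real^2"
    and \<rho> c :: "real \<Rightarrow> real"
  assumes positive: "\<rho>0 > 0" "c0 > 0" "\<rho>1 > 0" "c1 > 0" "K > 0" "d > 0"
    and media: "\<rho> = piecewise_const \<alpha> \<rho>0 \<rho>1" "c = piecewise_const \<alpha> c0 c1"
    and data: "p \<ge> 1" "C_diff p U0" "compact (supp U0)" "supp U0 \<subseteq> {..<\<alpha>}"
    and regular: "C1_up_to_boundary {..<\<alpha>} t0 U" "C1_up_to_boundary {\<alpha><..} t0 U"
    and branch: "\<And>t. t \<ge> t0 \<Longrightarrow> left_lim (\<lambda>x. stress U x t) \<alpha> < K * d"
    and pde: "\<And>x t. x \<noteq> \<alpha> \<Longrightarrow> t \<ge> t0 \<Longrightarrow>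
        dt t0 U x t + elastic_matrix (\<rho> x) (c x) *v dx U x t = 0"
    and jump_velocity: "\<And>t. t \<ge> t0 \<Longrightarrow>
        right_lim (\<lambda>x. velocity U x t) \<alpha> =
          left_lim (\<lambda>x. velocity U x t) \<alpha> +
          \<rho>0 * c0\<^sup>2 / K * (1 / (1 - left_lim (\<lambda>x. stress U x t) \<alpha> / (K * d))\<^sup>2) *
          left_lim (\<lambda>x. dx (velocity U) x t) \<alpha>"
    and jump_stress: "\<And>t. t \<ge> t0 \<Longrightarrow>
        right_lim (\<lambda>x. stress U x t) \<alpha> = left_lim (\<lambda>x. stress U x t) \<alpha>"
    and initial: "\<And>x. U x t0 = U0 x"
  shows "\<forall>t\<ge>t0.
    integrable lborel (energy_density \<rho> c U t) \<and>
    (energy \<alpha> \<rho> c K d U has_real_derivative 0) (at t within {t0..}) \<and>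
    energy \<alpha> \<rho> c K d U t \<ge> 0 \<and>
    (energy \<alpha> \<rho> c K d U t = 0 \<longleftrightarrow> (\<forall>x. x \<noteq> \<alpha> \<longrightarrow> U x t = 0))"
proof -
  have pde_left: "dt t0 U x t + elastic_matrix \<rho>0 c0 *v dx U x t = 0" if "x \<in> {..<\<alpha>}" "t \<ge> t0" for x t
    using pde[of x t] that by (simp add: media piecewise_const_def)
  have pde_right: "dt t0 U x t + elastic_matrix \<rho>1 c1 *v dx U x t = 0" if "x \<in> {\<alpha><..}" "t \<ge> t0" for x t
    using pde[of x t] that by (simp add: media piecewise_const_def)
  obtain v0 s0 vx0 sx0 where left: "elastic_medium {..<\<alpha>} t0 \<rho>0 c0 v0 s0 vx0 sx0"
    and left_eq: "\<And>x t. x < \<alpha> \<Longrightarrow> t \<ge> t0 \<Longrightarrow> velocity U x t = v0 x t"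
      "\<And>x t. x < \<alpha> \<Longrightarrow> t \<ge> t0 \<Longrightarrow> stress U x t = s0 x t"
      "\<And>x t. x < \<alpha> \<Longrightarrow> t \<ge> t0 \<Longrightarrow> dx (velocity U) x t = vx0 x t"
    using elastic_medium_of_solution[OF positive(1,2) open_lessThan convex_real_interval(4) regular(1) pde_left]
    unfolding lessThan_iff by metis
  obtain v1 s1 vx1 sx1 where right: "elastic_medium {\<alpha><..} t0 \<rho>1 c1 v1 s1 vx1 sx1"
    and right_eq: "\<And>x t. x > \<alpha> \<Longrightarrow> t \<ge> t0 \<Longrightarrow> velocity U x t = v1 x t"
      "\<And>x t. x > \<alpha> \<Longrightarrow> t \<ge> t0 \<Longrightarrow> stress U x t = s1 x t"
    using elastic_medium_of_solution[OF positive(3,4) open_greaterThan convex_real_interval(3) regular(2) pde_right]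
    unfolding greaterThan_iff by metis
  interpret L: elastic_medium "{..<\<alpha>}" t0 \<rho>0 c0 v0 s0 vx0 sx0 by fact
  interpret R: elastic_medium "{\<alpha><..}" t0 \<rho>1 c1 v1 s1 vx1 sx1 by fact
  have traces: "left_lim (\<lambda>x. velocity U x t) \<alpha> = v0 \<alpha> t" "left_lim (\<lambda>x. stress U x t) \<alpha> = s0 \<alpha> t"
    "left_lim (\<lambda>x. dx (velocity U) x t) \<alpha> = vx0 \<alpha> t"
    "right_lim (\<lambda>x. velocity U x t) \<alpha> = v1 \<alpha> t" "right_lim (\<lambda>x. stress U x t) \<alpha> = s1 \<alpha> t"
    if "t \<ge> t0" for t
    by (rule left_lim_eq[OF L.continuous_slices(1)[OF that]] left_lim_eq[OF L.continuous_slices(2)[OF that]]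
        left_lim_eq[OF L.continuous_slices(3)[OF that]] right_lim_eq[OF R.continuous_slices(1)[OF that]]
        right_lim_eq[OF R.continuous_slices(2)[OF that]]; use left_eq right_eq that in simp)+
  have branch': "s0 \<alpha> t < K * d" if "t \<ge> t0" for t
    using branch[OF that] traces(2)[OF that] by simp
  have U_eq_0: "U x t = 0 \<longleftrightarrow> velocity U x t = 0 \<and> stress U x t = 0" for x t
    by (simp add: vec_eq_iff forall_2 velocity_def stress_def)
  have density: "energy_density \<rho> c U t x = (if x < \<alpha> then L.density t x else R.density t x)"
    if "x \<noteq> \<alpha>" "t \<ge> t0" for x t
    using that left_eq right_eq
    by (auto simp: energy_density_def L.density_def R.density_def media piecewise_const_def)

  obtain r where r: "\<And>x. x \<in> supp U0 \<Longrightarrow> - r \<le> x"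
    using compact_imp_bounded[OF data(3)] by (auto simp: bounded_real) (metis abs_le_iff minus_le_iff)
  have "x \<in> supp U0" if "U0 x \<noteq> 0" for x
    using that closure_subset[of "{x. U0 x \<noteq> 0}"] by (auto simp: supp_def)
  then have at_rest: "U x t0 = 0" if "x < - r \<or> x \<ge> \<alpha>" for x
    using that r[of x] data(4) initial[of x] by force
  have rest_left: "v0 y t0 = 0 \<and> s0 y t0 = 0" if "y < min \<alpha> (- r)" for y
    using at_rest[of y] left_eq(1,2)[of y t0] U_eq_0[of y t0] that by simp
  have rest_right: "v1 y t0 = 0 \<and> s1 y t0 = 0" if "y > \<alpha>" for y
    using at_rest[of y] right_eq[of y t0] U_eq_0[of y t0] that by simp
  \<comment> \<open>The initial state is at rest to the left of \<open>min \<alpha> (- r)\<close> and on the whole right medium. The bounds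
    \<open>lo T\<close> and \<open>hi T\<close> are moved outwards by the distance waves travel until \<open>T\<close>; the additional unit
    makes both feet of the characteristics lie strictly inside the regions at rest.\<close>
  define lo where "lo T = min \<alpha> (- r) - 1 - c0 * (T - t0)" for T
  define hi where "hi T = \<alpha> + 1 + c1 * (T - t0)" for T
  have lo: "lo T < \<alpha>" and hi: "\<alpha> < hi T" if "T \<ge> t0" for T
  proof -
    have "0 \<le> c0 * (T - t0)" "0 \<le> c1 * (T - t0)"
      using that positive by simp_all
    then show "lo T < \<alpha>" "\<alpha> < hi T"
      unfolding lo_def hi_def by linarith+
  qed
  have quiet_left: "v0 x t = 0" "s0 x t = 0" if "x \<le> lo T" "t0 \<le> t" "t \<le> T" for x t T
  proof -
    have "c0 * (t - t0) \<le> c0 * (T - t0)" "0 \<le> c0 * (t - t0)"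
      using that positive by (auto intro: mult_left_mono)
    then have "x + c0 * (t - t0) < min \<alpha> (- r)" "x - c0 * (t - t0) < min \<alpha> (- r)" "x < \<alpha>"
      using \<open>x \<le> lo T\<close> unfolding lo_def by linarith+
    then show "v0 x t = 0" "s0 x t = 0"
      using L.finite_speed[of x t] rest_left \<open>t0 \<le> t\<close> by auto
  qed
  have quiet_right: "v1 x t = 0" "s1 x t = 0" if "hi T \<le> x" "t0 \<le> t" "t \<le> T" for x t T
  proof -
    have "c1 * (t - t0) \<le> c1 * (T - t0)" "0 \<le> c1 * (t - t0)"
      using that positive by (auto intro: mult_left_mono)
    then have "\<alpha> < x + c1 * (t - t0)" "\<alpha> < x - c1 * (t - t0)" "\<alpha> < x"
      using \<open>hi T \<le> x\<close> unfolding hi_def by linarith+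
    then show "v1 x t = 0" "s1 x t = 0"
      using R.finite_speed[of x t] rest_right \<open>t0 \<le> t\<close> by auto
  qed

  have cont_left: "continuous_on {lo T..\<alpha>} (L.density t)"
    and cont_right: "continuous_on {\<alpha>..hi T} (R.density t)" if "t \<ge> t0" for t T
    using L.continuous_on_density[OF that] R.continuous_on_density[OF that]
    by (auto intro: continuous_on_subset)
  have pieces: "integrable lborel (energy_density \<rho> c U t)"
    "(LINT x|lborel. energy_density \<rho> c U t x)
      = integral {lo T..\<alpha>} (L.density t) + integral {\<alpha>..hi T} (R.density t)"
    if "t0 \<le> t" "t \<le> T" for t T
  proof -
    have T: "T \<ge> t0" using that by simp
    have outside: "energy_density \<rho> c U t x = 0" if "x < lo T \<or> hi T < x" for x
      using that density[of x t] quiet_left[of x T t] quiet_right[of T x t] lo[OF T] hi[OF T] \<open>t0 \<le> t\<close> \<open>t \<le> T\<close>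
      by (auto simp: L.density_eq_0_iff R.density_eq_0_iff)
    have l: "energy_density \<rho> c U t x = L.density t x" if "lo T \<le> x" "x < \<alpha>" for x
      using that density[OF _ \<open>t0 \<le> t\<close>] by simp
    have r: "energy_density \<rho> c U t x = R.density t x" if "\<alpha> < x" "x \<le> hi T" for x
      using that density[OF _ \<open>t0 \<le> t\<close>] by simp
    note split = integral_two_pieces[where f = "energy_density \<rho> c U t",
        OF cont_left[OF \<open>t0 \<le> t\<close>] cont_right[OF \<open>t0 \<le> t\<close>] l r outside
          less_imp_le[OF lo[OF T]] less_imp_le[OF hi[OF T]]]
    show "integrable lborel (energy_density \<rho> c U t)"
      by (rule split(1))
    show "(LINT x|lborel. energy_density \<rho> c U t x)
        = integral {lo T..\<alpha>} (L.density t) + integral {\<alpha>..hi T} (R.density t)"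
      by (rule split(2))
  qed
  have energy_eq: "energy \<alpha> \<rho> c K d U t =
      1/2 * (integral {lo T..\<alpha>} (L.density t) + integral {\<alpha>..hi T} (R.density t))
      + fracture_energy K d (s0 \<alpha> t)"
    if "t0 \<le> t" "t \<le> T" for t T
    using pieces(2)[OF that] traces(2)[OF that(1)]
    by (simp add: energy_def Let_def fracture_energy_def)

  show ?thesis
  proof (intro allI impI conjI)
    fix t assume t: "t0 \<le> t"
    show "integrable lborel (energy_density \<rho> c U t)"
      using pieces(1)[OF t order.refl] .

    \<comment> \<open>The interval of integration must not depend on time near \<open>t\<close>, so it is taken for a later final time.\<close>
    define T where "T = t + 1"
    have T: "T \<ge> t0" using t by (simp add: T_def)
    define \<kappa> where "\<kappa> = K * (1 - s0 \<alpha> t / (K * d))\<^sup>2"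
    have \<kappa>: "\<kappa> \<noteq> 0" using branch'[OF t] positive by (simp add: \<kappa>_def)
    \<comment> \<open>The jump law, with \<open>\<rho>0 * c0\<^sup>2 * vx0 \<alpha> t\<close> being the time derivative of the trace of the stress.\<close>
    have jump: "v1 \<alpha> t = v0 \<alpha> t + \<rho>0 * c0\<^sup>2 * vx0 \<alpha> t / \<kappa>" "s1 \<alpha> t = s0 \<alpha> t"
      using jump_velocity[OF t] jump_stress[OF t] by (simp_all add: traces[OF t] \<kappa>_def)
    have "((\<lambda>\<tau>. integral {lo T..\<alpha>} (L.density \<tau>)) has_real_derivative
        2 * (v0 \<alpha> t * s0 \<alpha> t - v0 (lo T) t * s0 (lo T) t)) (at t within {t0..})"
      using lo[OF T] t by (intro L.energy_balance) auto
    moreover have "((\<lambda>\<tau>. integral {\<alpha>..hi T} (R.density \<tau>)) has_real_derivative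
        2 * (v1 (hi T) t * s1 (hi T) t - v1 \<alpha> t * s1 \<alpha> t)) (at t within {t0..})"
      using hi[OF T] t by (intro R.energy_balance) auto
    moreover have "((\<lambda>\<tau>. fracture_energy K d (s0 \<alpha> \<tau>)) has_real_derivative
        s0 \<alpha> t / \<kappa> * (\<rho>0 * c0\<^sup>2 * vx0 \<alpha> t)) (at t within {t0..})"
      unfolding \<kappa>_def using fracture_energy_deriv[OF _ _ branch'[OF t]] positive t
      by (intro DERIV_chain2[where f = "fracture_energy K d"] L.time_derivatives_on_closure(2)) auto
    ultimately have "((\<lambda>\<tau>. 1/2 * (integral {lo T..\<alpha>} (L.density \<tau>) + integral {\<alpha>..hi T} (R.density \<tau>))
          + fracture_energy K d (s0 \<alpha> \<tau>)) has_real_derivative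
        1/2 * (2 * (v0 \<alpha> t * s0 \<alpha> t - v0 (lo T) t * s0 (lo T) t)
          + 2 * (v1 (hi T) t * s1 (hi T) t - v1 \<alpha> t * s1 \<alpha> t))
        + s0 \<alpha> t / \<kappa> * (\<rho>0 * c0\<^sup>2 * vx0 \<alpha> t)) (at t within {t0..})"
      by (intro DERIV_add DERIV_cmult)
    moreover have "v0 (lo T) t = 0" "v1 (hi T) t = 0"
      using quiet_left[of "lo T" T t] quiet_right[of T "hi T" t] t by (auto simp: T_def)
    moreover have "1/2 * (2 * (v0 \<alpha> t * s0 \<alpha> t) - 2 * (v1 \<alpha> t * s1 \<alpha> t))
        + s0 \<alpha> t / \<kappa> * (\<rho>0 * c0\<^sup>2 * vx0 \<alpha> t) = 0"
      unfolding jump using \<kappa> by (simp add: field_simps)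
    ultimately have "((\<lambda>\<tau>. 1/2 * (integral {lo T..\<alpha>} (L.density \<tau>) + integral {\<alpha>..hi T} (R.density \<tau>))
          + fracture_energy K d (s0 \<alpha> \<tau>)) has_real_derivative 0) (at t within {t0..})"
      by simp
    then show "(energy \<alpha> \<rho> c K d U has_real_derivative 0) (at t within {t0..})"
    proof (rule has_field_derivative_transform_within[where d = 1])
      show "1/2 * (integral {lo T..\<alpha>} (L.density \<tau>) + integral {\<alpha>..hi T} (R.density \<tau>))
          + fracture_energy K d (s0 \<alpha> \<tau>) = energy \<alpha> \<rho> c K d U \<tau>"
        if "\<tau> \<in> {t0..}" "dist \<tau> t < 1" for \<tau>
        using energy_eq[of \<tau> T] that by (simp add: T_def dist_real_def)
    qed (use t in auto)

    have nonneg: "integral {lo t..\<alpha>} (L.density t) \<ge> 0" "integral {\<alpha>..hi t} (R.density t) \<ge> 0"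
      "fracture_energy K d (s0 \<alpha> t) \<ge> 0"
      using fracture_energy_nonneg[OF positive(5,6) branch'[OF t]]
        integrable_continuous_real[OF cont_left[OF t]] integrable_continuous_real[OF cont_right[OF t]]
      by (auto intro!: integral_nonneg L.density_nonneg R.density_nonneg)
    then show "energy \<alpha> \<rho> c K d U t \<ge> 0"
      using energy_eq[OF t order.refl] by simp
    show "energy \<alpha> \<rho> c K d U t = 0 \<longleftrightarrow> (\<forall>x. x \<noteq> \<alpha> \<longrightarrow> U x t = 0)"
    proof
      assume "energy \<alpha> \<rho> c K d U t = 0"
      then have sum_0: "1/2 * (integral {lo t..\<alpha>} (L.density t) + integral {\<alpha>..hi t} (R.density t))
          + fracture_energy K d (s0 \<alpha> t) = 0"
        using energy_eq[OF t order.refl] by simp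
      have vanish: "a = 0 \<and> b = 0" if "0 \<le> a" "0 \<le> b" "0 \<le> e" "1/2 * (a + b) + e = 0" for a b e :: real
        using that by (simp add: add_nonneg_eq_0_iff)
      have zero: "\<forall>x\<in>{lo t..\<alpha>}. L.density t x = 0" "\<forall>x\<in>{\<alpha>..hi t}. R.density t x = 0"
        using vanish[OF nonneg sum_0]
          integral_eq_0_iff[OF cont_left[OF t] lo[OF t]] integral_eq_0_iff[OF cont_right[OF t] hi[OF t]]
          L.density_nonneg R.density_nonneg by auto
      show "\<forall>x. x \<noteq> \<alpha> \<longrightarrow> U x t = 0"
      proof (intro allI impI)
        fix x assume "x \<noteq> \<alpha>"
        \<comment> \<open>Beyond \<open>lo t\<close> and \<open>hi t\<close> the state is at rest; between them the density is zero.\<close>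
        then consider "x \<le> lo t" "x < \<alpha>" | "x \<in> {lo t..\<alpha>}" "x < \<alpha>"
          | "hi t \<le> x" "\<alpha> < x" | "x \<in> {\<alpha>..hi t}" "\<alpha> < x" by fastforce
        then show "U x t = 0"
          using zero quiet_left[of x t t] quiet_right[of t x t] t left_eq(1,2)[of x t] right_eq(1,2)[of x t]
          by cases (auto simp: U_eq_0 L.density_eq_0_iff R.density_eq_0_iff)
      qed
    next
      assume zero: "\<forall>x. x \<noteq> \<alpha> \<longrightarrow> U x t = 0"
      then have "stress U x t = 0" if "x < \<alpha>" for x
        using U_eq_0[of x t] that by simp
      then have "left_lim (\<lambda>x. stress U x t) \<alpha> = 0"
        using left_lim_eq[of \<alpha> "\<lambda>_. 0" "\<lambda>x. stress U x t"] by simp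
      then have "fracture_energy K d (s0 \<alpha> t) = 0"
        using traces(2)[OF t] by (simp add: fracture_energy_def)
      moreover have "energy_density \<rho> c U t x = 0" if "x \<noteq> \<alpha>" for x
        using zero U_eq_0[of x t] that by (simp add: energy_density_def)
      then have "(LINT x|lborel. energy_density \<rho> c U t x) = 0"
        using integral_discrete_difference[of "{\<alpha>}" lborel "energy_density \<rho> c U t" "\<lambda>_. 0"] by simp
      ultimately show "energy \<alpha> \<rho> c K d U t = 0"
        using energy_eq[OF t order.refl] pieces(2)[OF t order.refl] by simp
    qed
  qed
qed

end
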